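(* Let $Q=(U,\leq)$ be a finite poset with $n$ elements and let $k\geq 1$ be an integer. Let $Z_Q$ be the flow network whose vertices are a source $s$, a sink $t$, and the vertices $V_1=\{x^-:x\in U\}$ and $V_2=\{y^+:y\in U\}$, and whose directed edges are: an edge from $x^-$ to $y^+$ of capacity $1$ for all $x,y\in U$ with $x<y$; an edge from $s$ to $x^-$ of capacity $k$ for every $x\in U$; and an edge from $y^+$ to $t$ of capacity $1$ for every $y\in U$. If $f$ is the value of a maximum $s$-$t$ flow in $Z_Q$, then $$k\text{-wd}(Q)=n-f,$$ where $k\text{-wd}(Q)$ is the $k$-width of $Q$.
   Context: A rooted tree is $k$-ary if every node has at most $k$ children. For a poset $Q=(U,\leq)$, a subset $A\subseteq U$ is called $k$-heapable (equivalently, a $k$-ary chain of $Q$) if there exist a $k$-ary rooted tree $T$ and a bijection between $A$ and the vertices of $T$ such that for all $i,j\in A$, if $j$ is a (proper) descendant of $i$ in $T$ then $i<j$ in $Q$. The $k$-width of $Q$, denoted $k\text{-wd}(Q)$, is the smallest number of classes in a partition of $U$ into $k$-ary chains. *)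

theory Defs
  imports
    Complex_Main
    "HOL-Library.Disjoint_Sets"
    "Graph_Theory.Digraph"
    "Graph_Theory.Arc_Walk"
begin

text \<open>Arcs point away from the root, from parents to children; uniqueness of the arc walk from
  the root excludes parallel arcs and cycles.\<close>

definition rooted_tree :: "('v, 'e) pre_digraph \<Rightarrow> 'v \<Rightarrow> bool" where
  "rooted_tree T \<rho> \<longleftrightarrow>
     wf_digraph T \<and> \<rho> \<in> verts T \<and>
     (\<forall>v \<in> verts T. \<exists>!p. pre_digraph.awalk T \<rho> p v)"

definition children :: "('v, 'e) pre_digraph \<Rightarrow> 'v \<Rightarrow> 'v set" where
  "children T v = {w. v \<rightarrow>\<^bsub>T\<^esub> w}"

definition kary_tree :: "nat \<Rightarrow> ('v, 'e) pre_digraph \<Rightarrow> 'v \<Rightarrow> bool" where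
  "kary_tree k T \<rho> \<longleftrightarrow>
     rooted_tree T \<rho> \<and> (\<forall>v \<in> verts T. finite (children T v) \<and> card (children T v) \<le> k)"

text \<open>A poset is a carrier \<open>U\<close> together with \<open>r\<close> such that \<^term>\<open>partial_order_on U r\<close>. The
  existential over trees needs some fixed vertex and arc type; \<open>'a\<close> and \<open>'a \<times> 'a\<close> have
  enough elements for every tree whose vertices are in bijection with \<open>A\<close>.\<close>

definition kary_chain :: "nat \<Rightarrow> 'a set \<Rightarrow> 'a rel \<Rightarrow> 'a set \<Rightarrow> bool" where
  "kary_chain k U r A \<longleftrightarrow>
     A \<subseteq> U \<and>
     (\<exists>(T :: ('a, 'a \<times> 'a) pre_digraph) \<rho> h.
        kary_tree k T \<rho> \<and> bij_betw h A (verts T) \<and>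
        (\<forall>i \<in> A. \<forall>j \<in> A. h i \<rightarrow>\<^sup>+\<^bsub>T\<^esub> h j \<longrightarrow> (i, j) \<in> r \<and> i \<noteq> j))"

definition k_width :: "nat \<Rightarrow> 'a set \<Rightarrow> 'a rel \<Rightarrow> nat" where
  "k_width k U r =
     (LEAST m. \<exists>P. partition_on U P \<and> finite P \<and> card P = m \<and> (\<forall>A \<in> P. kary_chain k U r A))"

record ('v, 'e) flow_network =
  net_graph :: "('v, 'e) pre_digraph"
  capacity :: "'e \<Rightarrow> real"
  source :: 'v
  sink :: 'v

definition is_flow :: "('v, 'e) flow_network \<Rightarrow> ('e \<Rightarrow> real) \<Rightarrow> bool" where
  "is_flow N \<phi> \<longleftrightarrow>
     (\<forall>e \<in> arcs (net_graph N). 0 \<le> \<phi> e \<and> \<phi> e \<le> capacity N e) \<and>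
     (\<forall>v \<in> verts (net_graph N) - {source N, sink N}.
        sum \<phi> (in_arcs (net_graph N) v) = sum \<phi> (out_arcs (net_graph N) v))"

definition flow_value :: "('v, 'e) flow_network \<Rightarrow> ('e \<Rightarrow> real) \<Rightarrow> real" where
  "flow_value N \<phi> =
     sum \<phi> (out_arcs (net_graph N) (source N)) - sum \<phi> (in_arcs (net_graph N) (source N))"

definition is_max_flow :: "('v, 'e) flow_network \<Rightarrow> ('e \<Rightarrow> real) \<Rightarrow> bool" where
  "is_max_flow N \<phi> \<longleftrightarrow>
     is_flow N \<phi> \<and> (\<forall>\<psi>. is_flow N \<psi> \<longrightarrow> flow_value N \<psi> \<le> flow_value N \<phi>)"

text \<open>\<open>Minus x\<close> and \<open>Plus y\<close> are the copies $x^-$ and $y^+$.\<close>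

datatype 'a node = Source | Sink | Minus 'a | Plus 'a

definition poset_network :: "nat \<Rightarrow> 'a set \<Rightarrow> 'a rel \<Rightarrow> ('a node, 'a node \<times> 'a node) flow_network" where
  "poset_network k U r =
     \<lparr> net_graph =
         \<lparr> verts = {Source, Sink} \<union> Minus ` U \<union> Plus ` U,
           arcs = {(Minus x, Plus y) | x y. x \<in> U \<and> y \<in> U \<and> (x, y) \<in> r \<and> x \<noteq> y}
             \<union> {(Source, Minus x) | x. x \<in> U}
             \<union> {(Plus y, Sink) | y. y \<in> U},
           tail = fst,
           head = snd \<rparr>,
       capacity = (\<lambda>(u, v). if u = Source then real k else 1),
       source = Source,
       sink = Sink \<rparr>"

end

theory Submission
  imports Defs "HOL-Library.Transitive_Closure_Table"
begin

text \<open>Both sides are compared with the largest number \<open>m\<close> of arcs in a system assigning to some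
  elements a strictly smaller parent, with at most \<open>k\<close> children per element. Such a system is a
  forest with one root for each element without a parent, and its components are \<open>k\<close>-ary chains;
  conversely, the trees of a partition into \<open>k\<close>-ary chains yield such a system. Hence the width is
  \<open>n - m\<close>. Such a system is also an integral flow of value \<open>m\<close>. If it is maximum, let \<open>Y\<close> be
  the set of elements reachable by alternating paths from the parentless ones, and \<open>X\<close> the set of
  elements below some member of \<open>Y\<close>. Every member of \<open>X\<close> has exactly \<open>k\<close> children, all in \<open>Y\<close>, as
  otherwise the system could be augmented. So \<open>m = k |X| + |U - Y|\<close>, which bounds every flow.\<close>

section \<open>Strict order and parent assignments\<close>

definition strict_part :: "'a set \<Rightarrow> 'a rel \<Rightarrow> 'a rel" where
  "strict_part U r = {(x, y). x \<in> U \<and> y \<in> U \<and> (x, y) \<in> r \<and> x \<noteq> y}"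

text \<open>This is a matching in the bipartite graph of \<open>L\<close> that may use each smaller
  element up to \<open>k\<close> times and each larger one once. A partial function builds in
  uniqueness of the parent, and its domain counts the arcs.\<close>

definition parent_map :: "nat \<Rightarrow> 'a rel \<Rightarrow> ('a \<rightharpoonup> 'a) \<Rightarrow> bool" where
  "parent_map k L p \<longleftrightarrow>
     (\<forall>y x. p y = Some x \<longrightarrow> (x, y) \<in> L) \<and> (\<forall>x. card {y. p y = Some x} \<le> k)"

lemma strict_part_subset: "strict_part U r \<subseteq> U \<times> U"
  by (auto simp: strict_part_def)

lemma finite_strict_part: "finite U \<Longrightarrow> finite (strict_part U r)"
  using strict_part_subset by (rule finite_subset) simp

text \<open>Antisymmetry keeps a composite of two strict steps strict. This turns the parent-child
  condition into the condition on all descendants that \<open>kary_chain\<close> demands.\<close>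

lemma trancl_strict_part:
  assumes "partial_order_on U r"
  shows "(strict_part U r)\<^sup>+ = strict_part U r"
proof (rule trancl_id, rule transI)
  have t: "trans r" and a: "antisym r"
    using assms by (auto simp: partial_order_on_def preorder_on_def)
  fix x y z assume "(x, y) \<in> strict_part U r" "(y, z) \<in> strict_part U r"
  then show "(x, z) \<in> strict_part U r"
    using t a by (auto simp: strict_part_def dest: transD antisymD)
qed

lemma parent_mapD: "parent_map k L p \<Longrightarrow> p y = Some x \<Longrightarrow> (x, y) \<in> L"
  by (auto simp: parent_map_def)

lemma parent_map_dom:
  assumes "parent_map k L p" "L \<subseteq> U \<times> U"
  shows "dom p \<subseteq> U"
  using assms by (auto simp: parent_map_def)

lemma parent_map_empty: "parent_map k L Map.empty"
  by (simp add: parent_map_def)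

section \<open>Augmenting paths and the bound on the flow\<close>

lemma parent_map_add:
  assumes "parent_map k L p" "p y = None" "(x, y) \<in> L" "card {z. p z = Some x} < k"
  shows "parent_map k L (p(y \<mapsto> x))"
proof -
  have "card {z. (p(y \<mapsto> x)) z = Some w} \<le> k" for w
  proof (cases "w = x")
    case True
    then have "{z. (p(y \<mapsto> x)) z = Some w} = insert y {z. p z = Some x}"
      using assms(2) by auto
    moreover have "card (insert y {z. p z = Some x}) \<le> Suc (card {z. p z = Some x})"
      by (rule card_insert_le_m1) simp_all
    ultimately show ?thesis using assms(4) by simp
  next
    case False
    then have "{z. (p(y \<mapsto> x)) z = Some w} = {z. p z = Some w}"
      using assms(2) by auto
    then show ?thesis using assms(1) by (simp add: parent_map_def)
  qed
  then show ?thesis using assms by (auto simp: parent_map_def)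
qed

text \<open>The element \<open>y\<close> takes the place of \<open>z\<close> among the children of
  \<open>x\<close>, so every load stays the same and only the parentless element moves from
  \<open>y\<close> to \<open>z\<close>.\<close>

lemma swap_child_count:
  assumes "finite (dom p)" "p y = None" "p z = Some x"
  shows "card {v. (p(y \<mapsto> x, z := None)) v = Some w} = card {v. p v = Some w}"
proof (cases "w = x")
  case True
  have yz: "y \<noteq> z" using assms by auto
  let ?S = "{v. p v = Some x}"
  have "finite ?S" using assms(1) by (rule rev_finite_subset) auto
  have "{v. (p(y \<mapsto> x, z := None)) v = Some w} = insert y (?S - {z})"
    using True yz by auto
  moreover have "card (insert y (?S - {z})) = Suc (card (?S - {z}))"
    using \<open>finite ?S\<close> assms(2) by (subst card_insert_disjoint) auto
  moreover have "\<dots> = card ?S"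
    using \<open>finite ?S\<close> assms(3) by (intro card_Suc_Diff1) auto
  ultimately show ?thesis using True by simp
next
  case False
  then have "{v. (p(y \<mapsto> x, z := None)) v = Some w} = {v. p v = Some w}"
    using assms by auto
  then show ?thesis by simp
qed

lemma swap_card_dom:
  assumes "finite (dom p)" "p y = None" "p z = Some x"
  shows "card (dom (p(y \<mapsto> x, z := None))) = card (dom p)"
proof -
  have yz: "y \<noteq> z" using assms by auto
  have "dom (p(y \<mapsto> x, z := None)) = insert y (dom p - {z})" using yz by auto
  moreover have "card (insert y (dom p - {z})) = Suc (card (dom p - {z}))"
    using assms by (subst card_insert_disjoint) auto
  moreover have "\<dots> = card (dom p)"
    using assms by (intro card_Suc_Diff1) auto
  ultimately show ?thesis by simp
qed

text \<open>Two edges of an alternating path are contracted into one step: some possible parent of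
  \<open>y\<close> currently has the child \<open>z\<close>, so \<open>y\<close> can be adopted if
  \<open>z\<close> is released.\<close>

definition alternating :: "'a rel \<Rightarrow> ('a \<rightharpoonup> 'a) \<Rightarrow> 'a \<Rightarrow> 'a \<Rightarrow> bool" where
  "alternating L p y z \<longleftrightarrow> (\<exists>x. (x, y) \<in> L \<and> p z = Some x)"

text \<open>A step inspects the map only at its endpoint, so changes at vertices outside
  \<open>ys\<close>, the start possibly included, do no harm.\<close>

lemma alternating_path_swap:
  assumes "rtrancl_path (alternating L p) y ys t" "\<And>v. v \<in> set ys \<Longrightarrow> q v = p v"
  shows "rtrancl_path (alternating L q) y ys t"
  using assms by induction (auto intro!: rtrancl_path.intros simp: alternating_def)

text \<open>Induction along the path: each swap hands the role of parentless element to the next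
  vertex and preserves all child counts, until \<open>t\<close> is parentless and is attached to
  \<open>x\<close>, which has a free place.\<close>

lemma augment:
  assumes "rtrancl_path (alternating L p) y ys t" "distinct (y # ys)"
    "parent_map k L p" "finite L" "p y = None"
    "(x, t) \<in> L" "card {v. p v = Some x} < k"
  shows "\<exists>q. parent_map k L q \<and> card (dom q) = Suc (card (dom p))"
  using assms
proof (induction ys arbitrary: y p)
  case Nil
  then have [simp]: "y = t" by (auto elim: rtrancl_path.cases)
  have fin: "finite (dom p)"
    using Nil.prems(4) by (rule finite_surj[where f = snd]) (use Nil.prems(3) parent_mapD in force)
  have "parent_map k L (p(t \<mapsto> x))" using Nil by (intro parent_map_add) auto
  moreover have "card (dom (p(t \<mapsto> x))) = Suc (card (dom p))"
    using Nil.prems(5) fin by (simp add: domIff)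
  ultimately show ?case by blast
next
  case (Cons z zs)
  have fin: "finite (dom p)"
    using Cons.prems(4) by (rule finite_surj[where f = snd]) (use Cons.prems(3) parent_mapD in force)
  from Cons.prems(1) have "alternating L p y z" and path: "rtrancl_path (alternating L p) z zs t"
    by (auto elim: rtrancl_path.cases)
  then obtain w where w: "(w, y) \<in> L" "p z = Some w" by (auto simp: alternating_def)
  define q where "q = p(y \<mapsto> w, z := None)"
  have count: "card {v. q v = Some u} = card {v. p v = Some u}" for u
    unfolding q_def using fin Cons.prems(5) w(2) by (rule swap_child_count)
  have q: "parent_map k L q"
    using Cons.prems(3) w count by (auto simp: parent_map_def q_def)
  \<comment> \<open>The swap altered the map only at \<open>y\<close> and \<open>z\<close>, and
    distinctness keeps both out of \<open>zs\<close>, so the rest of the path is still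
    alternating.\<close>
  have qpath: "rtrancl_path (alternating L q) z zs t"
    using path by (rule alternating_path_swap) (use Cons.prems(2) in \<open>auto simp: q_def\<close>)
  have "\<exists>q'. parent_map k L q' \<and> card (dom q') = Suc (card (dom q))"
    using Cons.prems(2,4,6,7) q count by (intro Cons.IH[OF qpath]) (simp_all, simp add: q_def)
  moreover have "card (dom q) = card (dom p)"
    unfolding q_def using fin Cons.prems(5) w(2) by (rule swap_card_dom)
  ultimately show ?case by simp
qed

text \<open>Were a place free at \<open>x\<close>, cutting the loops out of the alternating walk
  would leave a distinct path to which \<open>augment\<close> applies, against maximality.\<close>

lemma maximum_parent_map_saturated:
  assumes "parent_map k L p" "finite L"
    and max: "\<And>q. parent_map k L q \<Longrightarrow> card (dom q) \<le> card (dom p)"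
    and "(alternating L p)\<^sup>*\<^sup>* y t" "p y = None" "(x, t) \<in> L"
  shows "card {v. p v = Some x} = k"
proof (rule ccontr)
  assume "card {v. p v = Some x} \<noteq> k"
  then have less: "card {v. p v = Some x} < k"
    using assms(1) by (simp add: parent_map_def le_neq_implies_less)
  obtain ys where "rtrancl_path (alternating L p) y ys t" "distinct (y # ys)"
    using assms(4) by (metis rtranclp_eq_rtrancl_path rtrancl_path_distinct)
  from augment[OF this assms(1,2,5,6) less] max show False by fastforce
qed

text \<open>In the proof, \<open>X\<close> and \<open>U - Y\<close> form the vertex cover of Koenig's theorem, that is, a minimum
  cut; its vertices are weighted by \<open>k\<close> and \<open>1\<close>.\<close>

lemma fractional_parent_map_le:
  fixes g :: "'a \<Rightarrow> 'a \<Rightarrow> real"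
  assumes "finite U" "L \<subseteq> U \<times> U" "parent_map k L p"
    and max: "\<And>q. parent_map k L q \<Longrightarrow> card (dom q) \<le> card (dom p)"
    and nonneg: "\<And>x y. 0 \<le> g x y"
    and supp: "\<And>x y. (x, y) \<notin> L \<Longrightarrow> g x y = 0"
    and row: "\<And>x. x \<in> U \<Longrightarrow> (\<Sum>y\<in>U. g x y) \<le> real k"
    and col: "\<And>y. y \<in> U \<Longrightarrow> (\<Sum>x\<in>U. g x y) \<le> 1"
  shows "(\<Sum>x\<in>U. \<Sum>y\<in>U. g x y) \<le> card (dom p)"
proof -
  define Y where "Y = {t \<in> U. \<exists>y \<in> U. p y = None \<and> (alternating L p)\<^sup>*\<^sup>* y t}"
  define X where "X = {x. \<exists>y \<in> Y. (x, y) \<in> L}"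
  have "finite L" using assms(1,2) finite_subset by blast
  have XU: "X \<subseteq> U" and YU: "Y \<subseteq> U" using assms(2) by (auto simp: X_def Y_def)
  have fin: "finite X" "finite Y" using XU YU assms(1) finite_subset by auto
  have domU: "dom p \<subseteq> U" using parent_map_dom assms(2,3) by blast
  have sat: "card {v. p v = Some x} = k" if "x \<in> X" for x
    using that maximum_parent_map_saturated[OF assms(3) \<open>finite L\<close> max]
    by (auto simp: X_def Y_def)
  \<comment> \<open>A child \<open>v\<close> of \<open>x\<close> is one alternating step away from
    any \<open>t\<close> in \<open>Y\<close> above \<open>x\<close>, since \<open>t\<close> could
    replace it.\<close>
  have closed: "v \<in> Y" if "x \<in> X" "p v = Some x" for x v
  proof -
    from \<open>x \<in> X\<close> obtain y t where "y \<in> U" "p y = None" "(alternating L p)\<^sup>*\<^sup>* y t" "(x, t) \<in> L"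
      by (auto simp: X_def Y_def)
    moreover from this have "alternating L p t v" using that by (auto simp: alternating_def)
    ultimately have "(alternating L p)\<^sup>*\<^sup>* y v" by (meson rtranclp.rtrancl_into_rtrancl)
    with \<open>y \<in> U\<close> \<open>p y = None\<close> that domU show ?thesis by (auto simp: Y_def)
  qed
  \<comment> \<open>A parentless element of \<open>U\<close> reaches itself by the empty path and so
    lies in \<open>Y\<close>.\<close>
  have un: "U - Y \<subseteq> dom p" by (auto simp: Y_def)
  have Y_eq: "dom p \<inter> Y = (\<Union>x\<in>X. {v. p v = Some x})"
  proof (intro equalityI subsetI)
    fix v assume "v \<in> dom p \<inter> Y"
    moreover from this obtain x where "p v = Some x" by blast
    ultimately show "v \<in> (\<Union>x\<in>X. {v. p v = Some x})"
      using parent_mapD[OF assms(3)] unfolding X_def by blast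
  qed (use closed in blast)
  have "card (dom p \<inter> Y) = (\<Sum>x\<in>X. card {v. p v = Some x})"
    unfolding Y_eq using fin(1) domU assms(1)
    by (intro card_UN_disjoint) (auto intro: finite_subset[of _ U])
  also have "\<dots> = k * card X" using sat by simp
  finally have inY: "card (dom p \<inter> Y) = k * card X" .
  have "dom p = (dom p \<inter> Y) \<union> (U - Y)" using un domU by auto
  then have "card (dom p) = card (dom p \<inter> Y) + card (U - Y)"
    using assms(1) fin by (metis card_Un_disjoint Diff_disjoint finite_Diff finite_Int inf.assoc inf_bot_right)
  then have total: "card (dom p) = k * card X + card (U - Y)" using inY by simp
  \<comment> \<open>Arcs of \<open>L\<close> ending in \<open>Y\<close> start in \<open>X\<close>,
    so the columns in \<open>Y\<close> draw only on rows in \<open>X\<close>, each of total at most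
    \<open>k\<close>. The remaining columns contribute at most 1 each, which matches
    \<open>total\<close>.\<close>
  have "(\<Sum>y\<in>Y. \<Sum>x\<in>U. g x y) = (\<Sum>y\<in>Y. \<Sum>x\<in>X. g x y)"
    using XU assms(1) supp
    by (intro sum.cong refl sum.mono_neutral_right) (auto simp: X_def)
  also have "\<dots> = (\<Sum>x\<in>X. \<Sum>y\<in>Y. g x y)" by (rule sum.swap)
  also have "\<dots> \<le> (\<Sum>x\<in>X. \<Sum>y\<in>U. g x y)"
    by (rule sum_mono, rule sum_mono2[OF assms(1) YU nonneg])
  also have "\<dots> \<le> (\<Sum>x\<in>X. real k)"
    by (rule sum_mono) (use row XU in auto)
  finally have "(\<Sum>y\<in>Y. \<Sum>x\<in>U. g x y) \<le> (\<Sum>x\<in>X. real k)" .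
  moreover have "(\<Sum>y\<in>U - Y. \<Sum>x\<in>U. g x y) \<le> (\<Sum>y\<in>U - Y. 1)"
    by (rule sum_mono) (use col in auto)
  moreover have "(\<Sum>x\<in>U. \<Sum>y\<in>U. g x y) = (\<Sum>y\<in>U. \<Sum>x\<in>U. g x y)" by (rule sum.swap)
  moreover have "\<dots> = (\<Sum>y\<in>U - Y. \<Sum>x\<in>U. g x y) + (\<Sum>y\<in>Y. \<Sum>x\<in>U. g x y)"
    using YU assms(1) by (rule sum.subset_diff)
  ultimately show ?thesis using total by (simp add: mult.commute)
qed

section \<open>The flow network in coordinates\<close>

lemma poset_network_simps:
  "verts (net_graph (poset_network k U r)) = {Source, Sink} \<union> Minus ` U \<union> Plus ` U"
  "arcs (net_graph (poset_network k U r)) =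
     (\<lambda>(x, y). (Minus x, Plus y)) ` strict_part U r
       \<union> (\<lambda>x. (Source, Minus x)) ` U \<union> (\<lambda>y. (Plus y, Sink)) ` U"
  "tail (net_graph (poset_network k U r)) = fst"
  "head (net_graph (poset_network k U r)) = snd"
  "capacity (poset_network k U r) = (\<lambda>(u, v). if u = Source then real k else 1)"
  "source (poset_network k U r) = Source"
  "sink (poset_network k U r) = Sink"
  by (auto simp: poset_network_def strict_part_def)

lemma poset_network_arcs_at:
  fixes U :: "'a set" and r :: "'a rel" and k :: nat
  defines "G \<equiv> net_graph (poset_network k U r)"
  shows "out_arcs G Source = (\<lambda>x. (Source, Minus x)) ` U" "in_arcs G Source = {}"
    and "x \<in> U \<Longrightarrow> in_arcs G (Minus x) = {(Source, Minus x)}"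
    and "out_arcs G (Minus x) = (\<lambda>y. (Minus x, Plus y)) ` {y \<in> U. (x, y) \<in> strict_part U r}"
    and "in_arcs G (Plus y) = (\<lambda>x. (Minus x, Plus y)) ` {x \<in> U. (x, y) \<in> strict_part U r}"
    and "y \<in> U \<Longrightarrow> out_arcs G (Plus y) = {(Plus y, Sink)}"
  unfolding G_def in_arcs_def out_arcs_def poset_network_simps
  using strict_part_subset[of U r] by auto

text \<open>Reading the middle arcs as a matrix over \<open>U\<close>, with 0 off
  \<open>strict_part U r\<close>, makes conservation at \<open>Minus x\<close> and
  \<open>Plus y\<close> a statement about row and column sums.\<close>

lemma is_flow_poset_network:
  assumes "finite U"
  shows "is_flow (poset_network k U r) \<psi> \<longleftrightarrow>
     (\<forall>(x, y) \<in> strict_part U r. 0 \<le> \<psi> (Minus x, Plus y) \<and> \<psi> (Minus x, Plus y) \<le> 1) \<and>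
     (\<forall>x \<in> U. 0 \<le> \<psi> (Source, Minus x) \<and> \<psi> (Source, Minus x) \<le> real k) \<and>
     (\<forall>y \<in> U. 0 \<le> \<psi> (Plus y, Sink) \<and> \<psi> (Plus y, Sink) \<le> 1) \<and>
     (\<forall>x \<in> U. \<psi> (Source, Minus x) =
        (\<Sum>y\<in>U. if (x, y) \<in> strict_part U r then \<psi> (Minus x, Plus y) else 0)) \<and>
     (\<forall>y \<in> U. (\<Sum>x\<in>U. if (x, y) \<in> strict_part U r then \<psi> (Minus x, Plus y) else 0) =
        \<psi> (Plus y, Sink))"
proof -
  let ?G = "net_graph (poset_network k U r)"
  have out: "sum \<psi> (out_arcs ?G (Minus x)) =
      (\<Sum>y\<in>U. if (x, y) \<in> strict_part U r then \<psi> (Minus x, Plus y) else 0)" for x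
    unfolding poset_network_arcs_at using assms
    by (subst sum.reindex) (auto simp: inj_on_def sum.If_cases Int_def intro: sum.cong)
  have inn: "sum \<psi> (in_arcs ?G (Plus y)) =
      (\<Sum>x\<in>U. if (x, y) \<in> strict_part U r then \<psi> (Minus x, Plus y) else 0)" for y
    unfolding poset_network_arcs_at using assms
    by (subst sum.reindex) (auto simp: inj_on_def sum.If_cases Int_def intro: sum.cong)
  have "(\<forall>v \<in> verts ?G - {Source, Sink}. sum \<psi> (in_arcs ?G v) = sum \<psi> (out_arcs ?G v)) \<longleftrightarrow>
      (\<forall>x \<in> U. sum \<psi> (in_arcs ?G (Minus x)) = sum \<psi> (out_arcs ?G (Minus x))) \<and>
      (\<forall>y \<in> U. sum \<psi> (in_arcs ?G (Plus y)) = sum \<psi> (out_arcs ?G (Plus y)))"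
    unfolding poset_network_simps(1) by blast
  also have "\<dots> \<longleftrightarrow>
     (\<forall>x \<in> U. \<psi> (Source, Minus x) =
        (\<Sum>y\<in>U. if (x, y) \<in> strict_part U r then \<psi> (Minus x, Plus y) else 0)) \<and>
     (\<forall>y \<in> U. (\<Sum>x\<in>U. if (x, y) \<in> strict_part U r then \<psi> (Minus x, Plus y) else 0) =
        \<psi> (Plus y, Sink))"
    unfolding out inn by (simp add: poset_network_arcs_at)
  finally have conservation: "(\<forall>v \<in> verts ?G - {Source, Sink}.
      sum \<psi> (in_arcs ?G v) = sum \<psi> (out_arcs ?G v)) \<longleftrightarrow> \<dots>" .
  have bounds: "(\<forall>e \<in> arcs ?G. 0 \<le> \<psi> e \<and> \<psi> e \<le> capacity (poset_network k U r) e) \<longleftrightarrow>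
     (\<forall>(x, y) \<in> strict_part U r. 0 \<le> \<psi> (Minus x, Plus y) \<and> \<psi> (Minus x, Plus y) \<le> 1) \<and>
     (\<forall>x \<in> U. 0 \<le> \<psi> (Source, Minus x) \<and> \<psi> (Source, Minus x) \<le> real k) \<and>
     (\<forall>y \<in> U. 0 \<le> \<psi> (Plus y, Sink) \<and> \<psi> (Plus y, Sink) \<le> 1)"
    unfolding poset_network_simps(2,5) ball_Un ball_simps(9) by (simp add: split_beta)
  show ?thesis
    unfolding is_flow_def poset_network_simps(6,7) bounds conservation by (simp only: conj_assoc)
qed

lemma flow_value_poset_network:
  "flow_value (poset_network k U r) \<psi> = (\<Sum>x\<in>U. \<psi> (Source, Minus x))"
  unfolding flow_value_def poset_network_simps(6) poset_network_arcs_at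
  by (simp add: sum.reindex inj_on_def)

text \<open>The middle arcs of any flow form a fractional parent map, which gives the upper bound;
  the lower bound holds because \<open>p\<close> induces a flow and \<phi> is maximum.\<close>

lemma max_flow_value_eq_card:
  assumes "finite U" "parent_map k (strict_part U r) p"
    and max: "\<And>q. parent_map k (strict_part U r) q \<Longrightarrow> card (dom q) \<le> card (dom p)"
    and "is_max_flow (poset_network k U r) \<phi>"
  shows "flow_value (poset_network k U r) \<phi> = real (card (dom p))"
proof (rule antisym)
  \<comment> \<open>A flow is unconstrained outside the arcs, so its values there are replaced by 0.
    Source capacities then bound the rows of \<open>g\<close>, and sink capacities its
    columns.\<close>
  define g where "g x y = (if (x, y) \<in> strict_part U r then \<phi> (Minus x, Plus y) else 0)" for x y
  have flow: "is_flow (poset_network k U r) \<phi>" using assms(4) by (simp add: is_max_flow_def)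
  note F = flow[unfolded is_flow_poset_network[OF assms(1)], folded g_def]
  have "flow_value (poset_network k U r) \<phi> = (\<Sum>x\<in>U. \<Sum>y\<in>U. g x y)"
    unfolding flow_value_poset_network using F by (intro sum.cong) auto
  also have "\<dots> \<le> card (dom p)"
    by (rule fractional_parent_map_le[OF assms(1) strict_part_subset assms(2) max])
      (use F in \<open>auto simp: g_def\<close>)
  finally show "flow_value (poset_network k U r) \<phi> \<le> real (card (dom p))" .
next
  have domU: "dom p \<subseteq> U" using parent_map_dom strict_part_subset assms(2) by blast
  have finp: "finite {y. p y = Some x}" for x
    using assms(1) by (rule rev_finite_subset) (use domU in auto)
  \<comment> \<open>One unit runs from each parent to each of its children; conservation dictates
    the values on the source and sink arcs.\<close>
  define \<psi> :: "'a node \<times> 'a node \<Rightarrow> real" where "\<psi> = (\<lambda>e. case e of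
      (Source, Minus x) \<Rightarrow> real (card {y. p y = Some x})
    | (Minus x, Plus y) \<Rightarrow> of_bool (p y = Some x)
    | (Plus y, Sink) \<Rightarrow> of_bool (y \<in> dom p)
    | _ \<Rightarrow> 0)"
  have \<psi>_simps: "\<psi> (Source, Minus x) = real (card {y. p y = Some x})"
    "\<psi> (Minus x, Plus y) = of_bool (p y = Some x)" "\<psi> (Plus y, Sink) = of_bool (y \<in> dom p)"
    for x y by (auto simp: \<psi>_def)
  have restr: "(if (x, y) \<in> strict_part U r then \<psi> (Minus x, Plus y) else 0)
      = of_bool (p y = Some x)" for x y
    using parent_mapD[OF assms(2)] by (auto simp: \<psi>_simps)
  have row: "(\<Sum>y\<in>U. of_bool (p y = Some x)) = real (card {y. p y = Some x})" for x
  proof -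
    have "U \<inter> {y. p y = Some x} = {y. p y = Some x}" using domU by auto
    then show ?thesis using assms(1) by (simp add: of_bool_def sum.If_cases)
  qed
  have col: "(\<Sum>x\<in>U. of_bool (p y = Some x)) = (of_bool (y \<in> dom p) :: real)" for y
  proof (cases "p y")
    case (Some z)
    then have "z \<in> U" using parent_mapD[OF assms(2)] strict_part_subset by blast
    then have "(\<Sum>x\<in>U. of_bool (z = x)) = (1 :: real)"
      using assms(1) by (simp add: of_bool_def)
    then show ?thesis using Some by auto
  qed auto
  have "is_flow (poset_network k U r) \<psi>"
    unfolding is_flow_poset_network[OF assms(1)] restr
    unfolding row col \<psi>_simps
    using assms(2) by (auto simp: parent_map_def)
  then have "flow_value (poset_network k U r) \<psi> \<le> flow_value (poset_network k U r) \<phi>"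
    using assms(4) by (simp add: is_max_flow_def)
  moreover have "flow_value (poset_network k U r) \<psi> = (\<Sum>x\<in>U. \<Sum>y\<in>U. of_bool (p y = Some x))"
    by (simp add: flow_value_poset_network \<psi>_simps row)
  also have "\<dots> = (\<Sum>y\<in>U. of_bool (y \<in> dom p))"
    by (subst sum.swap) (simp add: col)
  also have "\<dots> = real (card (dom p))"
    using domU assms(1) by (simp add: of_bool_def sum.If_cases Int_absorb1)
  finally show "real (card (dom p)) \<le> flow_value (poset_network k U r) \<phi>" by simp
qed

section \<open>Forests and partitions into chains\<close>

text \<open>Every element has exactly one parentless ancestor, possibly itself. The descendants of
  each parentless element therefore form one class, and there are
  \<open>card U - card (dom p)\<close> such roots.\<close>

lemma parent_map_partition:
  fixes U :: "'a set"
  assumes "finite U" "partial_order_on U r" "parent_map k (strict_part U r) p"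
  shows "\<exists>P. partition_on U P \<and> finite P \<and> card P = card U - card (dom p) \<and>
     (\<forall>A \<in> P. kary_chain k U r A)"
proof -
  define F where "F = {(x, y). p y = Some x}"
  have FL: "F \<subseteq> strict_part U r" using parent_mapD[OF assms(3)] by (auto simp: F_def)
  have FpL: "F\<^sup>+ \<subseteq> strict_part U r"
    using trancl_mono_subset[OF FL] trancl_strict_part[OF assms(2)] by simp
  have domU: "dom p \<subseteq> U" using parent_map_dom strict_part_subset assms(3) by blast
  define A where "A \<rho> = F\<^sup>* `` {\<rho>}" for \<rho>
  define R where "R = U - dom p"
  have AU: "A \<rho> \<subseteq> U" if "\<rho> \<in> R" for \<rho>
  proof
    fix v assume "v \<in> A \<rho>"
    then have "(\<rho>, v) \<in> F\<^sup>*" by (simp add: A_def)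
    then show "v \<in> U" by (cases rule: rtranclE) (use that domU in \<open>auto simp: R_def F_def\<close>)
  qed
  have root_eq: "\<rho> = \<sigma>" if "\<sigma> \<in> R" "(\<rho>, \<sigma>) \<in> F\<^sup>*" for \<rho> \<sigma>
    using that(2) by (cases rule: rtranclE) (use that in \<open>auto simp: R_def F_def\<close>)
  have disj: "\<rho> = \<sigma>" if "(\<rho>, v) \<in> F\<^sup>*" "(\<sigma>, v) \<in> F\<^sup>*" "\<rho> \<in> R" "\<sigma> \<in> R" for \<rho> \<sigma> v
  proof -
    \<comment> \<open>Since parents are unique, climbing from \<open>v\<close> follows a single
      line, so two ancestors of \<open>v\<close> are comparable. A root has no proper ancestor,
      which forces equality.\<close>
    have "single_valued (F\<inverse>)" by (auto simp: single_valued_def F_def)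
    then have "(\<rho>, \<sigma>) \<in> F\<^sup>* \<or> (\<sigma>, \<rho>) \<in> F\<^sup>*"
      using single_valued_confluent[of "F\<inverse>" v \<rho> \<sigma>] that by (auto simp: rtrancl_converse)
    then show ?thesis using root_eq that by metis
  qed
  have "finite F"
    using FL finite_strict_part[OF assms(1)] by (rule finite_subset)
  moreover have "acyclic F" using FpL by (auto simp: acyclic_def strict_part_def)
  ultimately have wfF: "wf F" by (rule finite_acyclic_wf)
  \<comment> \<open>Well-founded induction climbs from \<open>v\<close> to its parent until a
    parentless element is reached.\<close>
  have root: "\<exists>\<rho> \<in> R. v \<in> A \<rho>" if "v \<in> U" for v
    using wfF that
  proof (induction v rule: wf_induct_rule)
    case (less v)
    show ?case
    proof (cases "p v")
      case None
      then show ?thesis using less by (auto simp: R_def A_def)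
    next
      case (Some x)
      then have "(x, v) \<in> F" "x \<in> U" using FL strict_part_subset by (auto simp: F_def)
      then obtain \<rho> where "\<rho> \<in> R" "x \<in> A \<rho>" using less.IH by blast
      then show ?thesis using \<open>(x, v) \<in> F\<close>
        by (auto simp: A_def intro: rtrancl_into_rtrancl)
    qed
  qed
  have chain: "kary_chain k U r (A \<rho>)" if \<rho>: "\<rho> \<in> R" for \<rho>
  proof -
    define T :: "('a, 'a \<times> 'a) pre_digraph"
      where "T = \<lparr>verts = A \<rho>, arcs = F \<inter> A \<rho> \<times> A \<rho>, tail = fst, head = snd\<rparr>"
    have Tsimps: "verts T = A \<rho>" "arcs T = F \<inter> A \<rho> \<times> A \<rho>" "tail T = fst" "head T = snd"
      by (simp_all add: T_def)
    interpret T: wf_digraph T by unfold_locales (auto simp: T_def)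
    have ends: "arcs_ends T = F \<inter> A \<rho> \<times> A \<rho>"
      unfolding arcs_ends_conv Tsimps by simp
    have \<rho>A: "\<rho> \<in> A \<rho>" by (simp add: A_def)
    have ex: "\<exists>ps. T.awalk \<rho> ps v" if "(\<rho>, v) \<in> F\<^sup>*" for v
      using that
    proof induction
      case base
      have "T.awalk \<rho> [] \<rho>" using \<rho>A by (simp add: T.awalk_Nil_iff Tsimps)
      then show ?case ..
    next
      case (step y z)
      then obtain ps where ps: "T.awalk \<rho> ps y" by blast
      have "y \<in> A \<rho>" "z \<in> A \<rho>" using step.hyps by (auto simp: A_def)
      then have "(y, z) \<in> arcs T" using step.hyps by (simp add: Tsimps)
      then have "T.awalk y [(y, z)] z" using T.arc_implies_awalk Tsimps by fastforce
      with ps show ?case by (blast intro: T.awalk_appendI)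
    qed
    have snoc_walk: "T.awalk \<rho> (ps @ [e]) v \<Longrightarrow> T.awalk \<rho> ps (fst e) \<and> e \<in> arcs T \<and> snd e = v" for ps e v
      by (auto simp: T.awalk_Cons_iff T.awalk_Nil_iff Tsimps)
    \<comment> \<open>Walks are compared from their last arc backwards: the arc entering
      \<open>v\<close> must come from the unique parent of \<open>v\<close>, and no arc enters
      \<rho>, so one walk cannot stop earlier than the other.\<close>
    have uniq: "ps = qs" if "T.awalk \<rho> ps v" "T.awalk \<rho> qs v" for ps qs v
      using that
    proof (induction ps arbitrary: qs v rule: rev_induct)
      case Nil
      then have "v = \<rho>" by (simp add: T.awalk_Nil_iff)
      show ?case
      proof (cases qs rule: rev_cases)
        case (snoc qs' e)
        then have "e \<in> F" "snd e = \<rho>"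
          using Nil \<open>v = \<rho>\<close> snoc_walk by (auto simp: Tsimps)
        then show ?thesis using \<rho> by (cases e) (auto simp: F_def R_def)
      qed simp
    next
      case (snoc e ps)
      note e = snoc_walk[OF snoc.prems(1)]
      show ?case
      proof (cases qs rule: rev_cases)
        case Nil
        then show ?thesis using snoc e \<rho>
          by (cases e) (auto simp: F_def R_def Tsimps T.awalk_Nil_iff)
      next
        case qs: (snoc qs' e')
        note e' = snoc_walk[OF snoc.prems(2)[unfolded qs]]
        have "e = e'"
          using e e' by (cases e; cases e') (auto simp: F_def Tsimps)
        with e e' snoc.IH qs show ?thesis by blast
      qed
    qed
    have "rooted_tree T \<rho>"
      unfolding rooted_tree_def
      using T.wf_digraph_axioms \<rho>A ex uniq by (auto simp: Tsimps A_def)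
    moreover have "finite (children T v) \<and> card (children T v) \<le> k" for v
    proof -
      have sub: "children T v \<subseteq> {y. p y = Some v}" by (auto simp: children_def ends F_def)
      have fin: "finite {y. p y = Some v}"
        using assms(1) by (rule rev_finite_subset) (use domU in auto)
      have "card (children T v) \<le> card {y. p y = Some v}" using fin sub by (rule card_mono)
      also have "\<dots> \<le> k" using assms(3) by (simp add: parent_map_def)
      finally show ?thesis using sub fin finite_subset by blast
    qed
    ultimately have "kary_tree k T \<rho>" by (simp add: kary_tree_def)
    moreover have "bij_betw id (A \<rho>) (verts T)" by (simp add: Tsimps)
    moreover have "(i, j) \<in> r \<and> i \<noteq> j" if "i \<rightarrow>\<^sup>+\<^bsub>T\<^esub> j" for i j
    proof -
      have "(i, j) \<in> F\<^sup>+" using that trancl_mono_subset[of "arcs_ends T" F] by (auto simp: ends)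
      then show ?thesis using FpL by (auto simp: strict_part_def)
    qed
    ultimately show ?thesis
      unfolding kary_chain_def using AU[OF \<rho>] by (metis id_apply)
  qed
  have self: "\<rho> \<in> A \<rho>" for \<rho> by (simp add: A_def)
  \<comment> \<open>Distinct roots have distinct trees, so counting classes amounts to counting
    parentless elements.\<close>
  have inj: "inj_on A R"
    using disj self by (auto simp: inj_on_def A_def) 
  have "partition_on U (A ` R)"
  proof (rule partition_onI)
    show "\<Union> (A ` R) = U" using AU root by blast
    show "{} \<notin> A ` R" using self by blast
    show "disjnt X Y" if "X \<in> A ` R" "Y \<in> A ` R" "X \<noteq> Y" for X Y
      using that disj by (auto simp: disjnt_def A_def)
  qed
  moreover have "card (A ` R) = card U - card (dom p)"
    using inj domU assms(1) by (simp add: card_image R_def card_Diff_subset finite_subset)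
  ultimately show ?thesis using chain assms(1) by (auto simp: R_def)
qed

text \<open>The trees of the classes supply the parents. Only the preimages of the roots can be left
  without one, and each class has a single root.\<close>

lemma partition_parent_map:
  assumes "finite U" "partition_on U P" "\<forall>A \<in> P. kary_chain k U r A"
  shows "\<exists>p. parent_map k (strict_part U r) p \<and> card U \<le> card (dom p) + card P"
proof -
  have "\<forall>A \<in> P. \<exists>(T :: ('a, 'a \<times> 'a) pre_digraph) \<rho> h.
      kary_tree k T \<rho> \<and> bij_betw h A (verts T) \<and>
      (\<forall>i \<in> A. \<forall>j \<in> A. h i \<rightarrow>\<^sup>+\<^bsub>T\<^esub> h j \<longrightarrow> (i, j) \<in> r \<and> i \<noteq> j)"
    using assms(3) by (simp add: kary_chain_def)
  from bchoice[OF this] obtain T :: "'a set \<Rightarrow> ('a, 'a \<times> 'a) pre_digraph"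
    where "\<forall>A \<in> P. \<exists>\<rho> h. kary_tree k (T A) \<rho> \<and> bij_betw h A (verts (T A)) \<and>
      (\<forall>i \<in> A. \<forall>j \<in> A. h i \<rightarrow>\<^sup>+\<^bsub>T A\<^esub> h j \<longrightarrow> (i, j) \<in> r \<and> i \<noteq> j)" ..
  from bchoice[OF this] obtain \<rho>
    where "\<forall>A \<in> P. \<exists>h. kary_tree k (T A) (\<rho> A) \<and> bij_betw h A (verts (T A)) \<and>
      (\<forall>i \<in> A. \<forall>j \<in> A. h i \<rightarrow>\<^sup>+\<^bsub>T A\<^esub> h j \<longrightarrow> (i, j) \<in> r \<and> i \<noteq> j)" ..
  from bchoice[OF this] obtain h
    where "\<forall>A \<in> P. kary_tree k (T A) (\<rho> A) \<and> bij_betw (h A) A (verts (T A)) \<and>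
      (\<forall>i \<in> A. \<forall>j \<in> A. h A i \<rightarrow>\<^sup>+\<^bsub>T A\<^esub> h A j \<longrightarrow> (i, j) \<in> r \<and> i \<noteq> j)" ..
  then have tree: "\<And>A. A \<in> P \<Longrightarrow> kary_tree k (T A) (\<rho> A)"
    and bij: "\<And>A. A \<in> P \<Longrightarrow> bij_betw (h A) A (verts (T A))"
    and desc: "\<And>A i j. A \<in> P \<Longrightarrow> i \<in> A \<Longrightarrow> j \<in> A \<Longrightarrow> h A i \<rightarrow>\<^sup>+\<^bsub>T A\<^esub> h A j
      \<Longrightarrow> (i, j) \<in> r \<and> i \<noteq> j"
    by simp_all
  have finP: "finite P" using assms(1,2) by (rule finite_elements)
  have PU: "A \<subseteq> U" if "A \<in> P" for A using that assms(2) by (auto simp: partition_on_def)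
  have same: "A = B" if "A \<in> P" "B \<in> P" "y \<in> A" "y \<in> B" for A B y
    using that assms(2) by (auto simp: partition_on_def disjoint_def)
  \<comment> \<open>Tree vertices need not be the elements they represent, so adjacency is pulled
    back along the bijections.\<close>
  define tree_arc where "tree_arc x y \<longleftrightarrow> (\<exists>A \<in> P. x \<in> A \<and> y \<in> A \<and> h A x \<rightarrow>\<^bsub>T A\<^esub> h A y)" for x y
  define p where "p y = (if \<exists>x. tree_arc x y then Some (SOME x. tree_arc x y) else None)" for y
  have p_arc: "tree_arc x y" if "p y = Some x" for x y
    using that by (auto simp: p_def split: if_splits intro: someI)
  have "parent_map k (strict_part U r) p"
    unfolding parent_map_def
  proof (intro conjI allI impI)
    fix x y assume "p y = Some x"
    from p_arc[OF this] desc PU show "(x, y) \<in> strict_part U r"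
      unfolding tree_arc_def strict_part_def by blast
  next
    fix x
    show "card {y. p y = Some x} \<le> k"
    proof (cases "\<exists>A \<in> P. x \<in> A")
      case True
      then obtain A where A: "A \<in> P" "x \<in> A" by blast
      \<comment> \<open>Classes are disjoint, so all children of \<open>x\<close> stay in its own
        class \<open>A\<close>. There \<open>h A\<close> embeds them into the children of one tree
        node, of which there are at most \<open>k\<close>.\<close>
      have sub: "{y. p y = Some x} \<subseteq> A" "h A ` {y. p y = Some x} \<subseteq> children (T A) (h A x)"
        using p_arc same A unfolding tree_arc_def children_def by blast+
      have "inj_on (h A) {y. p y = Some x}"
        using bij[OF A(1)] sub(1) by (auto simp: bij_betw_def intro: inj_on_subset)
      moreover have "h A x \<in> verts (T A)" using bij A by (auto simp: bij_betw_def)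
      then have "finite (children (T A) (h A x))" "card (children (T A) (h A x)) \<le> k"
        using tree[OF A(1)] by (auto simp: kary_tree_def)
      ultimately show ?thesis using sub(2) by (meson card_inj_on_le order_trans)
    next
      case False
      then have "{y. p y = Some x} = {}" using p_arc by (auto simp: tree_arc_def)
      then show ?thesis by simp
    qed
  qed
  moreover have "U \<subseteq> dom p \<union> (\<lambda>A. inv_into A (h A) (\<rho> A)) ` P"
  proof
    fix y assume "y \<in> U"
    then obtain A where A: "A \<in> P" "y \<in> A" using assms(2) by (auto simp: partition_on_def)
    have inj: "inj_on (h A) A" and img: "h A ` A = verts (T A)"
      using bij[OF A(1)] by (auto simp: bij_betw_def)
    show "y \<in> dom p \<union> (\<lambda>A. inv_into A (h A) (\<rho> A)) ` P"
    proof (cases "h A y = \<rho> A")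
      case True
      then have "y = inv_into A (h A) (\<rho> A)" using inj A by (metis inv_into_f_f)
      then show ?thesis using A by blast
    next
      case False
      have rt: "rooted_tree (T A) (\<rho> A)" using tree[OF A(1)] by (simp add: kary_tree_def)
      interpret wf_digraph "T A" using rt by (simp add: rooted_tree_def)
      have "h A y \<in> verts (T A)" using img A by blast
      then obtain ps where ps: "awalk (\<rho> A) ps (h A y)"
        using rt unfolding rooted_tree_def by blast
      \<comment> \<open>The walk from the root to a different vertex is nonempty, and its last arc
        provides the parent.\<close>
      with False have "\<rho> A \<rightarrow>\<^sup>+\<^bsub>T A\<^esub> h A y"
        by (metis awalk_Nil_iff reachable1_awalkI)
      then obtain w where w: "w \<rightarrow>\<^bsub>T A\<^esub> h A y" by (metis tranclE)
      then have "w \<in> h A ` A" unfolding img by (rule adj_in_verts)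
      then obtain x where "x \<in> A" "h A x = w" by (elim imageE) simp
      then have "tree_arc x y" using w A unfolding tree_arc_def by blast
      then show ?thesis by (auto simp: p_def)
    qed
  qed
  then have "card U \<le> card (dom p \<union> (\<lambda>A. inv_into A (h A) (\<rho> A)) ` P)"
    using finP parent_map_dom[OF calculation strict_part_subset] assms(1)
    by (intro card_mono) (auto intro: finite_subset)
  then have "card U \<le> card (dom p) + card P"
    using card_Un_le[of "dom p"] card_image_le[OF finP] by (meson add_left_mono order_trans)
  ultimately show ?thesis by blast
qed

section \<open>The width as the number of elements minus the maximum flow\<close>

theorem corollary2:
  fixes U :: "'a set" and r :: "'a rel" and k n :: nat and f :: real
    and \<phi> :: "'a node \<times> 'a node \<Rightarrow> real"
  assumes "finite U"
    and "partial_order_on U r"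
    and "card U = n"
    and "k \<ge> 1"
    and "is_max_flow (poset_network k U r) \<phi>"
    and "f = flow_value (poset_network k U r) \<phi>"
  shows "real (k_width k U r) = real n - f"
proof -
  let ?L = "strict_part U r"
  have bound: "card (dom q) \<le> card U" if "parent_map k ?L q" for q
    using assms(1) parent_map_dom[OF that strict_part_subset] by (rule card_mono)
  \<comment> \<open>A maximum exists because the empty map qualifies and all domains lie in the
    finite set \<open>U\<close>.\<close>
  obtain p where p: "parent_map k ?L p"
    and max: "\<And>q. parent_map k ?L q \<Longrightarrow> card (dom q) \<le> card (dom p)"
    using ex_has_greatest_nat[of "parent_map k ?L" Map.empty "\<lambda>q. card (dom q)" "Suc (card U)"]
      parent_map_empty[of k ?L] bound by (auto simp: less_Suc_eq_le)
  have "k_width k U r = card U - card (dom p)"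
    unfolding k_width_def
  proof (rule Least_equality)
    show "\<exists>P. partition_on U P \<and> finite P \<and> card P = card U - card (dom p) \<and>
        (\<forall>A \<in> P. kary_chain k U r A)"
      using assms(1,2) p by (rule parent_map_partition)
  next
    fix m
    assume "\<exists>P. partition_on U P \<and> finite P \<and> card P = m \<and> (\<forall>A \<in> P. kary_chain k U r A)"
    then obtain P where P: "partition_on U P" "card P = m" "\<forall>A \<in> P. kary_chain k U r A" by blast
    from partition_parent_map[OF assms(1) P(1,3)] P(2) max
    show "card U - card (dom p) \<le> m" by fastforce
  qed
  moreover have "f = real (card (dom p))"
    unfolding assms(6) using assms(1) p max assms(5) by (rule max_flow_value_eq_card)
  \<comment> \<open>By \<open>bound\<close> the subtraction of natural numbers is not truncated, so
    it agrees with the real one.\<close>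
  ultimately show ?thesis using bound[OF p] assms(3) by simp
qed

end
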